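(* Let $\mathcal{I}$ be a graphical model, let $\boldsymbol{X}\sim\mu_{\mathcal{I}}$, and let $(D,\Phi_D)$ be an update, fixed independently of $\boldsymbol{X}$, that modifies $\mathcal{I}$ to $\mathcal{I}'$. Run the Dynamic Sampler on $(\mathcal{I},\boldsymbol{X})$ with update $(D,\Phi_D)$. Then, upon termination, the Dynamic Sampler returns a perfect sample $\boldsymbol{X}'\sim\mu_{\mathcal{I}'}$.
   Context: A graphical model is $\mathcal{I}=(V,E,[q],\Phi)$: $V$ is a finite set of variables taking values in $[q]=\{1,\dots,q\}$; $E\subseteq 2^V$ is a set of constraints, each $e\in E$ with $|e|>1$; $\Phi=(\phi_a)_{a\in V\cup E}$ where each $\phi_v:[q]\to\mathbb{R}_{\ge0}$ is a probability distribution on $[q]$ and each $\phi_e:[q]^e\to[0,1]$. The weight of $\sigma\in[q]^V$ is $w(\sigma)=\prod_{v\in V}\phi_v(\sigma_v)\prod_{e\in E}\phi_e(\sigma_e)$ ($\sigma_e$ is the restriction of $\sigma$ to $e$) and the Gibbs distribution is $\mu_{\mathcal{I}}(\sigma)=w(\sigma)/\sum_{\tau}w(\tau)$. For $S\subseteq V$: $E(S)=\{e\in E: e\subseteq S\}$, $\delta(S)=\{e\in E: e\not\subseteq S,\ e\cap S\neq\emptyset\}$, $E^+(S)=E(S)\cup\delta(S)$. For $D\subseteq V\cup E$ (or $V\cup 2^V$), $\mathrm{vbl}(D)=(D\cap V)\cup\bigcup_{e\in D,\,e\subseteq V,\,|e|>1}e$, i.e. the variables in $D$ together with the variables of the constraints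 in $D$. An update is a pair $(D,\Phi_D)$ where $D\subseteq V\cup 2^V$ consists of variables, existing constraints, or new constraints $e\subseteq V$ with $|e|>1$, and $\Phi_D=(\phi_a)_{a\in D}$ gives new functions for them; applying it to $\mathcal{I}$ (replacing/adding these functions and constraints) yields $\mathcal{I}'$. Local-Resample$(\mathcal{I},\boldsymbol{X},\mathcal{R})$, for $\mathcal{I}=(V,E,[q],\Phi)$, $\boldsymbol{X}\in[q]^V$, $\mathcal{R}\subseteq V$: (1) for each $e\in E^+(\mathcal{R})$ compute $\kappa_e=\frac{1}{\phi_e(X_e)}\min_{x\in[q]^e:\,x_{e\cap\mathcal{R}}=X_{e\cap\mathcal{R}}}\phi_e(x)$ (convention $0/0=1$), using the current $\boldsymbol{X}$; (2) for each $v\in\mathcal{R}$ independently resample $X_v$ from $\phi_v$; (3) for each $e\in E^+(\mathcal{R})$ independently sample $F_e\in\{0,1\}$ with $\Pr[F_e=0]=\kappa_e\cdot\phi_e(X_e)$, where $X$ is now the resampled configuration (and $F_e=0$ for other $e$); (4) return $(\boldsymbol{X},\mathcal{R}')$ with $\mathcal{R}'=\bigcup_{e\in E:F_e=1}e$. Dynamic Sampler on input $(\mathcal{I},\boldsymbol{X})$ and update $(D,\Phi_D)$ producing $\mathcal{I}'$: set $\mathcal{R}\gets\mathrm{vbl}(D)$; while $\mathcal{R}\neq\emptyset$, set $(\boldsymbol{X},\mathcal{R})\gets$ Local-Resample$(\mathcal{I}',\boldsymbol{X},\mathcal{R})$; return $\boldsymbol{X}$. *)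

theory Defs
  imports "HOL-Probability.Probability" "HOL-Probability.Product_PMF" "HOL-Probability.SPMF"
begin

(* The family Phi is split into its variable part vfun and its constraint part cfun.
   Configurations on a set S of variables are extensional functions in PiE S [q];
   cfun e is only ever applied to elements of PiE e [q]. *)
record 'v gmodel =
  vars :: "'v set"
  constraints :: "'v set set"
  num_spins :: nat
  vfun :: "'v \<Rightarrow> nat pmf"
  cfun :: "'v set \<Rightarrow> ('v \<Rightarrow> nat) \<Rightarrow> real"

definition configs :: "'v gmodel \<Rightarrow> 'v set \<Rightarrow> ('v \<Rightarrow> nat) set" where
  "configs I S = (S \<rightarrow>\<^sub>E {1..num_spins I})"

definition graphical_model :: "'v gmodel \<Rightarrow> bool" where
  "graphical_model I \<longleftrightarrow>
     finite (vars I) \<and>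
     (\<forall>e\<in>constraints I. e \<subseteq> vars I \<and> card e > 1) \<and>
     (\<forall>v\<in>vars I. set_pmf (vfun I v) \<subseteq> {1..num_spins I}) \<and>
     (\<forall>e\<in>constraints I. \<forall>x\<in>configs I e. 0 \<le> cfun I e x \<and> cfun I e x \<le> 1)"

definition weight :: "'v gmodel \<Rightarrow> ('v \<Rightarrow> nat) \<Rightarrow> real" where
  "weight I \<sigma> =
     (\<Prod>v\<in>vars I. pmf (vfun I v) (\<sigma> v)) * (\<Prod>e\<in>constraints I. cfun I e (restrict \<sigma> e))"

definition gibbs :: "'v gmodel \<Rightarrow> ('v \<Rightarrow> nat) \<Rightarrow> real" where
  "gibbs I \<sigma> =
     (if \<sigma> \<in> configs I (vars I)
      then weight I \<sigma> / (\<Sum>\<tau>\<in>configs I (vars I). weight I \<tau>) else 0)"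

definition inner_constraints :: "'v gmodel \<Rightarrow> 'v set \<Rightarrow> 'v set set" where
  "inner_constraints I S = {e \<in> constraints I. e \<subseteq> S}"

definition boundary_constraints :: "'v gmodel \<Rightarrow> 'v set \<Rightarrow> 'v set set" where
  "boundary_constraints I S = {e \<in> constraints I. \<not> e \<subseteq> S \<and> e \<inter> S \<noteq> {}}"

definition incident_constraints :: "'v gmodel \<Rightarrow> 'v set \<Rightarrow> 'v set set" where
  "incident_constraints I S = inner_constraints I S \<union> boundary_constraints I S"

(* The set D of an update is upd_vars together with upd_constraints. *)
record 'v update =
  upd_vars :: "'v set"
  upd_constraints :: "'v set set"
  upd_vfun :: "'v \<Rightarrow> nat pmf"
  upd_cfun :: "'v set \<Rightarrow> ('v \<Rightarrow> nat) \<Rightarrow> real"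

definition valid_update :: "'v gmodel \<Rightarrow> 'v update \<Rightarrow> bool" where
  "valid_update I U \<longleftrightarrow>
     upd_vars U \<subseteq> vars I \<and>
     (\<forall>e\<in>upd_constraints U. e \<subseteq> vars I \<and> card e > 1) \<and>
     (\<forall>v\<in>upd_vars U. set_pmf (upd_vfun U v) \<subseteq> {1..num_spins I}) \<and>
     (\<forall>e\<in>upd_constraints U. \<forall>x\<in>configs I e. 0 \<le> upd_cfun U e x \<and> upd_cfun U e x \<le> 1)"

definition apply_update :: "'v gmodel \<Rightarrow> 'v update \<Rightarrow> 'v gmodel" where
  "apply_update I U =
     \<lparr>vars = vars I,
      constraints = constraints I \<union> upd_constraints U,
      num_spins = num_spins I,
      vfun = override_on (vfun I) (upd_vfun U) (upd_vars U),
      cfun = override_on (cfun I) (upd_cfun U) (upd_constraints U)\<rparr>"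

lemma graphical_model_apply_update:
  assumes "graphical_model I" "valid_update I U"
  shows "graphical_model (apply_update I U)"
  using assms
  by (auto simp: graphical_model_def valid_update_def apply_update_def configs_def override_on_def)

definition vbl :: "'v update \<Rightarrow> 'v set" where
  "vbl U = upd_vars U \<union> \<Union>(upd_constraints U)"

definition kappa :: "'v gmodel \<Rightarrow> ('v \<Rightarrow> nat) \<Rightarrow> 'v set \<Rightarrow> 'v set \<Rightarrow> real" where
  "kappa I X R e =
     (let m = Min (cfun I e ` {x \<in> configs I e. \<forall>v\<in>e \<inter> R. x v = X v});
          c = cfun I e (restrict X e)
      in if m = 0 \<and> c = 0 then 1 else m / c)"

(* F e = True encodes F_e = 1. *)
definition local_resample ::
  "'v gmodel \<Rightarrow> ('v \<Rightarrow> nat) \<Rightarrow> 'v set \<Rightarrow> (('v \<Rightarrow> nat) \<times> 'v set) pmf" where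
  "local_resample I X R =
     bind_pmf (Pi_pmf R undefined (vfun I)) (\<lambda>Y.
       let X' = override_on X Y R in
       bind_pmf
         (Pi_pmf (incident_constraints I R) False
           (\<lambda>e. bernoulli_pmf (1 - kappa I X R e * cfun I e (restrict X' e))))
         (\<lambda>F. return_pmf (X', \<Union>{e \<in> constraints I. F e})))"

(* Least fixed point in the order of sub-probability mass functions:
   the missing mass is the probability of non-termination. *)
partial_function (spmf) resample_loop ::
  "'v gmodel \<Rightarrow> ('v \<Rightarrow> nat) \<Rightarrow> 'v set \<Rightarrow> ('v \<Rightarrow> nat) spmf" where
  "resample_loop I X R =
     (if R = {} then return_spmf X
      else bind_spmf (spmf_of_pmf (local_resample I X R))
             (\<lambda>XR. resample_loop I (fst XR) (snd XR)))"

definition dynamic_sampler ::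
  "'v gmodel \<Rightarrow> 'v update \<Rightarrow> ('v \<Rightarrow> nat) \<Rightarrow> ('v \<Rightarrow> nat) spmf" where
  "dynamic_sampler I U X = resample_loop (apply_update I U) X (vbl U)"

end

theory Submission
  imports Defs
begin

text \<open>
  The invariant is the conditional Gibbs property of Feng, Vishnoi and Yin, kept unnormalised so
  that vanishing partition functions need no special treatment: the joint mass of the pair
  \<open>(X, R)\<close> has the form \<open>d(X) * g\<^sub>R(X)\<close>, where \<open>d\<close> depends only on the values of \<open>X\<close> on \<open>R\<close> and
  \<open>g\<^sub>R\<close> is the product of all factors not contained in \<open>R\<close>. It holds initially for the new model because
  \<open>R\<close> covers every modified factor. A resampling step preserves it: for a constraint on the boundary
  of \<open>R\<close>, the factor \<open>\<kappa>\<^sub>e\<close> cancels the old value \<open>\<phi>\<^sub>e(X\<^sub>e)\<close> and leaves a minimum that depends only on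
  the part of \<open>X\<close> that is being erased, while constraints that fail are contained in the next \<open>R\<close>. When \<open>R\<close> is
  empty, \<open>d\<close> is constant and \<open>g\<^sub>R\<close> is the Gibbs weight, so every run that halts within \<open>n\<close> steps
  contributes a multiple of the Gibbs weight; let \<open>n\<close> tend to infinity.
\<close>

section \<open>Truncated runs of the resampling loop and their limit\<close>

text \<open>Exhausted fuel counts as missing mass. The final test for an empty \<open>R\<close> also
  costs one unit, so fuel \<open>Suc n\<close> allows at most \<open>n\<close> resamplings.\<close>

primrec loop_upto :: "'v gmodel \<Rightarrow> nat \<Rightarrow> ('v \<Rightarrow> nat) \<Rightarrow> 'v set \<Rightarrow> ('v \<Rightarrow> nat) spmf" where
  "loop_upto I 0 X R = return_pmf None"
| "loop_upto I (Suc n) X R =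
     (if R = {} then return_spmf X
      else bind_spmf (spmf_of_pmf (local_resample I X R))
             (\<lambda>XR. loop_upto I n (fst XR) (snd XR)))"

lemma ord_spmf_loop_upto_Suc: "ord_spmf (=) (loop_upto I n X R) (loop_upto I (Suc n) X R)"
proof (induction n arbitrary: X R)
  case (Suc n)
  show ?case
    by (subst (1 2) loop_upto.simps) (auto intro!: bind_spmf_mono' Suc.IH simp del: loop_upto.simps bind_spmf_of_pmf)
qed simp

lemma ord_spmf_loop_upto_resample_loop: "ord_spmf (=) (loop_upto I n X R) (resample_loop I X R)"
proof (induction n arbitrary: X R)
  case (Suc n)
  show ?case
    by (subst resample_loop.simps) (auto intro!: bind_spmf_mono' Suc.IH simp del: bind_spmf_of_pmf)
qed simp

lemma incseq_spmf_loop_upto: "incseq (\<lambda>n. spmf (loop_upto I n X R) \<sigma>)"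
  by (intro incseq_SucI ord_spmf_eq_leD ord_spmf_loop_upto_Suc)

text \<open>The lower bound holds because each truncation lies below the loop; the upper bound is
  fixed-point induction, as the loop is the least solution of its equation. Working in
  \<open>ennreal\<close> makes suprema and integrals unconditional.\<close>

lemma ennreal_spmf_resample_loop:
  "ennreal (spmf (resample_loop I X R) \<sigma>) = (SUP n. ennreal (spmf (loop_upto I n X R) \<sigma>))"
proof (rule antisym)
  show "(SUP n. ennreal (spmf (loop_upto I n X R) \<sigma>)) \<le> ennreal (spmf (resample_loop I X R) \<sigma>)"
    by (intro SUP_least ennreal_leI ord_spmf_eq_leD ord_spmf_loop_upto_resample_loop)
  have "\<forall>I X R. ennreal (spmf (resample_loop I X R) \<sigma>) \<le> (SUP n. ennreal (spmf (loop_upto I n X R) \<sigma>))"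
  proof (induction rule: resample_loop.fixp_induct)
    case 1
    show ?case by simp
  next
    case 2
    show ?case by simp
  next
    case (3 f)
    show ?case
    proof (intro allI)
      fix I :: "'a gmodel" and X R
      let ?B = "SUP n. ennreal (spmf (loop_upto I n X R) \<sigma>)"
      have Suc_le: "ennreal (spmf (loop_upto I (Suc n) X R) \<sigma>) \<le> ?B" for n
        by (rule SUP_upper) simp
      show "ennreal (spmf (if R = {} then return_spmf X
              else bind_spmf (spmf_of_pmf (local_resample I X R)) (\<lambda>XR. f I (fst XR) (snd XR))) \<sigma>) \<le> ?B"
      proof (cases "R = {}")
        case True
        \<comment> \<open>One unit of fuel is enough to return \<open>X\<close>.\<close>
        then show ?thesis using Suc_le[of 0] by simp
      next
        case False
        let ?M = "measure_spmf (spmf_of_pmf (local_resample I X R))"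
        have "ennreal (spmf (bind_spmf (spmf_of_pmf (local_resample I X R)) (\<lambda>XR. f I (fst XR) (snd XR))) \<sigma>)
            = (\<integral>\<^sup>+ y. ennreal (spmf (f I (fst y) (snd y)) \<sigma>) \<partial>?M)"
          by (rule ennreal_spmf_bind)
        also have "\<dots> \<le> (\<integral>\<^sup>+ y. (SUP n. ennreal (spmf (loop_upto I n (fst y) (snd y)) \<sigma>)) \<partial>?M)"
          using 3 by (intro nn_integral_mono) simp
        \<comment> \<open>Monotone convergence applies because the truncations increase pointwise in
          \<open>n\<close>.\<close>
        also have "\<dots> = (SUP n. \<integral>\<^sup>+ y. ennreal (spmf (loop_upto I n (fst y) (snd y)) \<sigma>) \<partial>?M)"
          by (rule nn_integral_monotone_convergence_SUP)
            (auto intro!: incseq_SucI le_funI ennreal_leI ord_spmf_eq_leD ord_spmf_loop_upto_Suc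
              simp del: loop_upto.simps)
        also have "\<dots> = (SUP n. ennreal (spmf (loop_upto I (Suc n) X R) \<sigma>))"
          using False by (simp add: ennreal_spmf_bind del: bind_spmf_of_pmf)
        also have "\<dots> \<le> ?B"
          by (intro SUP_least Suc_le)
        finally show ?thesis using False by simp
      qed
    qed
  qed
  then show "ennreal (spmf (resample_loop I X R) \<sigma>) \<le> (SUP n. ennreal (spmf (loop_upto I n X R) \<sigma>))"
    by blast
qed

lemma LIMSEQ_spmf_loop_upto:
  "(\<lambda>n. spmf (loop_upto I n X R) \<sigma>) \<longlonglongrightarrow> spmf (resample_loop I X R) \<sigma>"
proof -
  have "incseq (\<lambda>n. ennreal (spmf (loop_upto I n X R) \<sigma>))"
    using incseq_spmf_loop_upto[of I X R \<sigma>] by (auto simp: incseq_def intro: ennreal_leI)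
  from LIMSEQ_SUP[OF this] show ?thesis
    unfolding ennreal_spmf_resample_loop[symmetric] by simp
qed


section \<open>Ingredients of the invariant and elementary bounds on the filter\<close>

text \<open>Quantifying over all functions, not only configurations, makes \<open>d\<close> outright
  constant when \<open>R\<close> is empty.\<close>

definition depends_on :: "'v set \<Rightarrow> (('v \<Rightarrow> nat) \<Rightarrow> real) \<Rightarrow> bool" where
  "depends_on R d \<longleftrightarrow> (\<forall>\<sigma> \<tau>. (\<forall>v\<in>R. \<sigma> v = \<tau> v) \<longrightarrow> d \<sigma> = d \<tau>)"

text \<open>Up to normalisation, the conditional Gibbs density off \<open>R\<close> given the values
  on \<open>R\<close>. Boundary constraints are kept; only those inside \<open>R\<close> are
  dropped.\<close>

definition outer_weight :: "'v gmodel \<Rightarrow> 'v set \<Rightarrow> ('v \<Rightarrow> nat) \<Rightarrow> real" where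
  "outer_weight I R \<sigma> =
     (\<Prod>v\<in>vars I - R. pmf (vfun I v) (\<sigma> v)) *
     (\<Prod>e\<in>{e \<in> constraints I. \<not> e \<subseteq> R}. cfun I e (restrict \<sigma> e))"

text \<open>The numerator of \<open>kappa\<close>, separated because it sees \<sigma> only through
  \<open>e \<inter> R\<close>.\<close>

definition min_factor :: "'v gmodel \<Rightarrow> ('v \<Rightarrow> nat) \<Rightarrow> 'v set \<Rightarrow> 'v set \<Rightarrow> real" where
  "min_factor I \<sigma> R e = Min (cfun I e ` {x \<in> configs I e. \<forall>v\<in>e \<inter> R. x v = \<sigma> v})"

lemma graphical_modelD:
  assumes "graphical_model I"
  shows "finite (vars I)" "e \<in> constraints I \<Longrightarrow> e \<subseteq> vars I" "e \<in> constraints I \<Longrightarrow> e \<noteq> {}"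
    "v \<in> vars I \<Longrightarrow> set_pmf (vfun I v) \<subseteq> {1..num_spins I}"
    "e \<in> constraints I \<Longrightarrow> x \<in> configs I e \<Longrightarrow> 0 \<le> cfun I e x"
    "e \<in> constraints I \<Longrightarrow> x \<in> configs I e \<Longrightarrow> cfun I e x \<le> 1"
  using assms by (auto simp: graphical_model_def)

lemma finite_constraints: "graphical_model I \<Longrightarrow> finite (constraints I)"
  by (rule finite_subset[of _ "Pow (vars I)"]) (auto dest: graphical_modelD)

lemma finite_configs: "finite S \<Longrightarrow> finite (configs I S)"
  by (simp add: configs_def finite_PiE)

lemma restrict_in_configs: "\<sigma> \<in> configs I S \<Longrightarrow> e \<subseteq> S \<Longrightarrow> restrict \<sigma> e \<in> configs I e"
  by (auto simp: configs_def PiE_iff)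

lemma override_on_in_configs:
  assumes "\<tau> \<in> configs I S" "\<And>v. v \<in> R \<Longrightarrow> \<rho> v \<in> {1..num_spins I}" "R \<subseteq> S"
  shows "override_on \<tau> \<rho> R \<in> configs I S"
  using assms by (auto simp: configs_def PiE_iff override_on_def extensional_def)

lemma min_factor_bounds:
  assumes "graphical_model I" "e \<in> constraints I" "\<sigma> \<in> configs I (vars I)"
  shows "0 \<le> min_factor I \<sigma> R e" "min_factor I \<sigma> R e \<le> cfun I e (restrict \<sigma> e)"
proof -
  let ?A = "{x \<in> configs I e. \<forall>v\<in>e \<inter> R. x v = \<sigma> v}"
  have "finite e"
    using graphical_modelD(1,2)[OF assms(1)] assms(2) finite_subset by blast
  then have fin: "finite ?A"
    by (simp add: finite_configs)
  have mem: "restrict \<sigma> e \<in> ?A"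
    using restrict_in_configs[OF assms(3)] graphical_modelD(2)[OF assms(1,2)] by auto
  show "min_factor I \<sigma> R e \<le> cfun I e (restrict \<sigma> e)"
    unfolding min_factor_def using fin mem by (intro Min_le) auto
  show "0 \<le> min_factor I \<sigma> R e"
    unfolding min_factor_def using fin mem graphical_modelD(5)[OF assms(1,2)]
    by (subst Min_ge_iff) auto
qed

lemma kappa_altdef:
  "kappa I \<sigma> R e =
     (if min_factor I \<sigma> R e = 0 \<and> cfun I e (restrict \<sigma> e) = 0 then 1
      else min_factor I \<sigma> R e / cfun I e (restrict \<sigma> e))"
  by (simp add: kappa_def min_factor_def Let_def)

text \<open>If the denominator vanishes, the minimum is squeezed to 0 as well, so both sides are 0
  under the convention 0/0 = 1.\<close>

lemma kappa_mult_cfun: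
  assumes "graphical_model I" "e \<in> constraints I" "\<sigma> \<in> configs I (vars I)"
  shows "kappa I \<sigma> R e * cfun I e (restrict \<sigma> e) = min_factor I \<sigma> R e"
  using min_factor_bounds[OF assms, of R] by (auto simp: kappa_altdef)

lemma kappa_bounds:
  assumes "graphical_model I" "e \<in> constraints I" "\<sigma> \<in> configs I (vars I)"
  shows "0 \<le> kappa I \<sigma> R e" "kappa I \<sigma> R e \<le> 1"
  using min_factor_bounds[OF assms, of R] by (auto simp: kappa_altdef divide_le_eq_1)

lemma min_factor_cong:
  "(\<And>v. v \<in> e \<inter> R \<Longrightarrow> \<sigma> v = \<tau> v) \<Longrightarrow> min_factor I \<sigma> R e = min_factor I \<tau> R e"
  unfolding min_factor_def by (intro arg_cong[of _ _ Min] image_cong) auto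

lemma kappa_cong:
  assumes "\<And>v. v \<in> e \<Longrightarrow> \<sigma> v = \<tau> v"
  shows "kappa I \<sigma> R e = kappa I \<tau> R e"
  using min_factor_cong[of e R \<sigma> \<tau> I] restrict_cong[of e e \<sigma> \<tau>] assms
  by (simp add: kappa_altdef simp_implies_def)

text \<open>Constraints are nonempty, so one contained in \<open>R\<close> also meets
  \<open>R\<close>.\<close>

lemma incident_constraints_altdef:
  assumes "graphical_model I"
  shows "incident_constraints I R = {e \<in> constraints I. e \<inter> R \<noteq> {}}"
  using graphical_modelD(3)[OF assms]
  by (auto simp: incident_constraints_def inner_constraints_def boundary_constraints_def)

section \<open>Transition probabilities of one resampling step\<close>

text \<open>Different sets of failed constraints can have the same union, hence the sum over
  \<open>S\<close>. On the support, \<open>F\<close> is \<open>False\<close> off \<open>A\<close>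
  and is thus the indicator of some such \<open>S\<close>.\<close>

lemma pmf_map_Union_Pi_pmf_bernoulli:
  assumes "finite A" "A \<subseteq> C"
  shows "pmf (map_pmf (\<lambda>F. \<Union>{e \<in> C. F e}) (Pi_pmf A False (\<lambda>e. bernoulli_pmf (p e)))) R' =
    (\<Sum>S\<in>{S \<in> Pow A. \<Union>S = R'}. \<Prod>e\<in>A. pmf (bernoulli_pmf (p e)) (e \<in> S))"
proof -
  let ?M = "Pi_pmf A False (\<lambda>e. bernoulli_pmf (p e))"
  let ?T = "{S \<in> Pow A. \<Union>S = R'}"
  let ?\<chi> = "\<lambda>S e. e \<in> S"
  have fin: "finite ?T"
    using assms by simp
  have inj: "inj_on ?\<chi> ?T"
    by (auto simp: inj_on_def fun_eq_iff)
  have supp: "F e \<Longrightarrow> e \<in> A" if "F \<in> set_pmf ?M" for F e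
    using set_Pi_pmf_subset[OF assms(1), of False "\<lambda>e. bernoulli_pmf (p e)"] that by blast
  have "pmf (map_pmf (\<lambda>F. \<Union>{e \<in> C. F e}) ?M) R' =
      measure_pmf.prob ?M ((\<lambda>F. \<Union>{e \<in> C. F e}) -` {R'})"
    by (rule pmf_map)
  also have "\<dots> = measure_pmf.prob ?M (?\<chi> ` ?T)"
  proof (rule measure_pmf.finite_measure_eq_AE)
    show "AE F in ?M. F \<in> (\<lambda>F. \<Union>{e \<in> C. F e}) -` {R'} \<longleftrightarrow> F \<in> ?\<chi> ` ?T"
    proof (rule AE_pmfI, rule iffI)
      fix F assume F: "F \<in> set_pmf ?M" "F \<in> (\<lambda>F. \<Union>{e \<in> C. F e}) -` {R'}"
      have "{e. F e} = {e \<in> C. F e}"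
        using supp[OF F(1)] assms(2) by auto
      then have "{e. F e} \<in> ?T"
        using supp[OF F(1)] F(2) by auto
      then show "F \<in> ?\<chi> ` ?T"
        by (intro image_eqI[of _ _ "{e. F e}"]) simp_all
    next
      fix F assume "F \<in> ?\<chi> ` ?T"
      then obtain S where S: "S \<in> ?T" "F = ?\<chi> S" by blast
      then have "{e \<in> C. F e} = S"
        using assms(2) by auto
      then show "F \<in> (\<lambda>F. \<Union>{e \<in> C. F e}) -` {R'}"
        using S by auto
    qed
  qed auto
  also have "\<dots> = (\<Sum>S\<in>?T. pmf ?M (?\<chi> S))"
    using fin inj by (simp add: measure_measure_pmf_finite sum.reindex)
  also have "\<dots> = (\<Sum>S\<in>?T. \<Prod>e\<in>A. pmf (bernoulli_pmf (p e)) (e \<in> S))"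
    using assms by (intro sum.cong refl pmf_Pi') auto
  finally show ?thesis .
qed

text \<open>The outcome \<tau> determines the fresh values on \<open>R\<close> and forces agreement
  with \<sigma> elsewhere; the sum over \<open>S\<close> then accounts for all failure patterns that
  produce \<open>R'\<close>.\<close>

lemma pmf_local_resample:
  assumes gm: "graphical_model I" and R: "R \<subseteq> vars I"
    and \<sigma>: "\<sigma> \<in> configs I (vars I)" and \<tau>: "\<tau> \<in> configs I (vars I)"
  shows "pmf (local_resample I \<sigma> R) (\<tau>, R') =
    (if \<forall>v. v \<notin> R \<longrightarrow> \<sigma> v = \<tau> v
     then (\<Prod>v\<in>R. pmf (vfun I v) (\<tau> v)) *
       (\<Sum>S\<in>{S \<in> Pow (incident_constraints I R). \<Union>S = R'}. \<Prod>e\<in>incident_constraints I R.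
          if e \<in> S then 1 - kappa I \<sigma> R e * cfun I e (restrict \<tau> e)
          else kappa I \<sigma> R e * cfun I e (restrict \<tau> e))
     else 0)"
proof -
  let ?E = "incident_constraints I R"
  let ?N = "Pi_pmf R undefined (vfun I)"
  define M where
    "M X' = map_pmf (\<lambda>F. \<Union>{e \<in> constraints I. F e})
       (Pi_pmf ?E False (\<lambda>e. bernoulli_pmf (1 - kappa I \<sigma> R e * cfun I e (restrict X' e))))" for X'
  have finR: "finite R"
    using R graphical_modelD(1)[OF gm] finite_subset by blast
  have E: "?E \<subseteq> constraints I"
    by (auto simp: incident_constraints_altdef[OF gm])
  then have finE: "finite ?E"
    using finite_constraints[OF gm] finite_subset by blast
  have LR: "local_resample I \<sigma> R =
      bind_pmf ?N (\<lambda>Y. map_pmf (Pair (override_on \<sigma> Y R)) (M (override_on \<sigma> Y R)))"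
    unfolding local_resample_def Let_def M_def map_pmf_comp by (simp add: map_pmf_def)
  have pair: "pmf (map_pmf (Pair X') P) (\<tau>, R') = (if X' = \<tau> then pmf P R' else 0)"
    for X' :: "'a \<Rightarrow> nat" and P
  proof (cases "X' = \<tau>")
    case True
    then show ?thesis using pmf_map_inj'[of "Pair \<tau>" P R'] by (simp add: inj_on_def)
  next
    case False
    then have "(\<tau>, R') \<notin> Pair X' ` set_pmf P" by blast
    then show ?thesis using False by (simp add: pmf_map_outside)
  qed
  have "pmf (local_resample I \<sigma> R) (\<tau>, R') =
      (\<integral>Y. (if override_on \<sigma> Y R = \<tau> then pmf (M (override_on \<sigma> Y R)) R' else 0) \<partial>?N)"
    unfolding LR pmf_bind pair ..
  \<comment> \<open>A single \<open>Y\<close> contributes: the default \<open>undefined\<close> of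
    \<open>Pi_pmf\<close> is also the value of \<open>restrict\<close> off \<open>R\<close>.\<close>
  also have "\<dots> = (\<Sum>Y\<in>{restrict \<tau> R}. pmf ?N Y *\<^sub>R
      (if override_on \<sigma> Y R = \<tau> then pmf (M (override_on \<sigma> Y R)) R' else 0))"
  proof (rule integral_measure_pmf)
    fix Y assume Y: "Y \<in> set_pmf ?N"
      and "(if override_on \<sigma> Y R = \<tau> then pmf (M (override_on \<sigma> Y R)) R' else 0) \<noteq> 0"
    then have ov: "override_on \<sigma> Y R = \<tau>" by (auto split: if_splits)
    have "Y v = undefined" if "v \<notin> R" for v
      using set_Pi_pmf_subset[OF finR, of undefined "vfun I"] Y that by blast
    then have "Y v = restrict \<tau> R v" for v
      using fun_cong[OF ov, of v]
      by (auto simp: restrict_def override_on_def split: if_splits)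
    then show "Y \<in> {restrict \<tau> R}" by auto
  qed simp
  also have "\<dots> = (if \<forall>v. v \<notin> R \<longrightarrow> \<sigma> v = \<tau> v
      then (\<Prod>v\<in>R. pmf (vfun I v) (\<tau> v)) * pmf (M \<tau>) R' else 0)"
  proof -
    have "override_on \<sigma> (restrict \<tau> R) R = \<tau> \<longleftrightarrow> (\<forall>v. v \<notin> R \<longrightarrow> \<sigma> v = \<tau> v)"
      by (auto simp: override_on_def fun_eq_iff)
    moreover have "pmf ?N (restrict \<tau> R) = (\<Prod>v\<in>R. pmf (vfun I v) (\<tau> v))"
      using finR by (subst pmf_Pi') auto
    ultimately show ?thesis by auto
  qed
  also have "pmf (M \<tau>) R' =
      (\<Sum>S\<in>{S \<in> Pow ?E. \<Union>S = R'}. \<Prod>e\<in>?E.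
         if e \<in> S then 1 - kappa I \<sigma> R e * cfun I e (restrict \<tau> e)
         else kappa I \<sigma> R e * cfun I e (restrict \<tau> e))"
    unfolding M_def pmf_map_Union_Pi_pmf_bernoulli[OF finE E]
  proof (intro sum.cong prod.cong refl)
    fix S e assume "e \<in> ?E"
    then have e: "e \<in> constraints I" using E by blast
    have \<tau>e: "restrict \<tau> e \<in> configs I e"
      using \<tau> graphical_modelD(2)[OF gm e] by (rule restrict_in_configs)
    let ?q = "kappa I \<sigma> R e * cfun I e (restrict \<tau> e)"
    \<comment> \<open>The explicit Bernoulli probabilities are valid only for a parameter in the
      unit interval.\<close>
    have "0 \<le> ?q" "?q \<le> 1"
      using kappa_bounds[OF gm e \<sigma>, of R] graphical_modelD(5,6)[OF gm e \<tau>e]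
      by (auto intro: mult_nonneg_nonneg mult_le_one)
    then show "pmf (bernoulli_pmf (1 - ?q)) (e \<in> S) = (if e \<in> S then 1 - ?q else ?q)"
      by (cases "e \<in> S") auto
  qed
  finally show ?thesis .
qed


section \<open>One resampling step preserves the invariant\<close>

text \<open>For fixed \<open>R'\<close> the incoming mass is a sum over erased values on
  \<open>R\<close> and failure patterns. Each summand is a product over variables and constraints,
  so the factors of \<open>outer_weight I R'\<close> can be extracted one constraint at a time; what
  is left must not see \<tau> off \<open>R'\<close>.\<close>

lemma local_resample_outer_weight:
  assumes gm: "graphical_model I" and R: "R \<subseteq> vars I" and d: "depends_on R d"
  shows "\<exists>c. depends_on R' c \<and> (\<forall>\<tau>\<in>configs I (vars I).
    (\<Sum>\<sigma>\<in>configs I (vars I). d \<sigma> * outer_weight I R \<sigma> * pmf (local_resample I \<sigma> R) (\<tau>, R'))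
      = c \<tau> * outer_weight I R' \<tau>)"
proof -
  let ?V = "vars I" and ?C = "constraints I" and ?E = "incident_constraints I R"
  let ?T = "{S \<in> Pow (incident_constraints I R). \<Union>S = R'}"
  have E: "?E = {e \<in> ?C. e \<inter> R \<noteq> {}}"
    by (rule incident_constraints_altdef[OF gm])
  note finV = graphical_modelD(1)[OF gm] and finC = finite_constraints[OF gm]
  text \<open>For an erased configuration \<open>\<rho>\<close> on \<open>R\<close>, the result \<open>\<tau>\<close> of the step comes from \<open>s \<rho> \<tau>\<close>. The set
    \<open>S\<close> collects the failed constraints, \<open>a e \<rho> S \<tau>\<close> is the total contribution of the constraint \<open>e\<close>, and
    \<open>b e \<rho> S \<tau>\<close> is what remains of it once the factor of \<open>e\<close> in \<open>outer_weight I R' \<tau>\<close> is taken out.\<close>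
  define s where "s \<rho> \<tau> = override_on \<tau> \<rho> R" for \<rho> \<tau> :: "'a \<Rightarrow> nat"
  define f where "f e \<rho> S \<tau> =
    (if e \<in> S then 1 - kappa I (s \<rho> \<tau>) R e * cfun I e (restrict \<tau> e)
     else kappa I (s \<rho> \<tau>) R e * cfun I e (restrict \<tau> e))" for e \<rho> S \<tau>
  define a where "a e \<rho> S \<tau> =
    (if e \<subseteq> R then 1 else cfun I e (restrict (s \<rho> \<tau>) e)) * (if e \<in> ?E then f e \<rho> S \<tau> else 1)" for e \<rho> S \<tau>
  define b where "b e \<rho> S \<tau> =
    (if e \<subseteq> R' then a e \<rho> S \<tau> else if e \<subseteq> R then kappa I (s \<rho> \<tau>) R e
     else if e \<in> ?E then min_factor I (s \<rho> \<tau>) R e else 1)" for e \<rho> S \<tau>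
  \<comment> \<open>All that remains after extracting \<open>outer_weight I R' \<tau>\<close>,
    summed over the forgotten data \<rho> and \<open>S\<close>. Variables in \<open>R'\<close> stay
    here since the outer weight omits them.\<close>
  define c where "c \<tau> = (\<Sum>\<rho>\<in>configs I R. \<Sum>S\<in>?T.
    d (s \<rho> \<tau>) * (\<Prod>v\<in>?V \<inter> R'. pmf (vfun I v) (\<tau> v)) * (\<Prod>e\<in>?C. b e \<rho> S \<tau>))" for \<tau>

  have "depends_on R' c"
    unfolding depends_on_def
  proof (intro allI impI)
    fix \<sigma> \<tau> :: "'a \<Rightarrow> nat" assume eq: "\<forall>v\<in>R'. \<sigma> v = \<tau> v"
    have d_eq: "d (s \<rho> \<sigma>) = d (s \<rho> \<tau>)" for \<rho>
      using d by (auto simp: depends_on_def s_def)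
    have b_eq: "b e \<rho> S \<sigma> = b e \<rho> S \<tau>" for e \<rho> S
    proof (cases "e \<subseteq> R'")
      case True
      then have e: "\<And>v. v \<in> e \<Longrightarrow> \<sigma> v = \<tau> v" using eq by blast
      then have s: "\<And>v. v \<in> e \<Longrightarrow> s \<rho> \<sigma> v = s \<rho> \<tau> v"
        by (simp add: s_def override_on_def)
      have "restrict \<sigma> e = restrict \<tau> e" "restrict (s \<rho> \<sigma>) e = restrict (s \<rho> \<tau>) e"
        using e s by (auto intro: restrict_ext)
      then show ?thesis
        using True kappa_cong[OF s, where I = I and R = R] by (simp add: b_def a_def f_def)
    next
      \<comment> \<open>The remaining values of \<open>b\<close> read \<open>s \<rho> \<tau>\<close>
        only on \<open>R\<close>, where it equals \<rho>.\<close>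
      case False
      have "min_factor I (s \<rho> \<sigma>) R e = min_factor I (s \<rho> \<tau>) R e"
        by (rule min_factor_cong) (auto simp: s_def)
      moreover have "kappa I (s \<rho> \<sigma>) R e = kappa I (s \<rho> \<tau>) R e" if "e \<subseteq> R"
        using that by (intro kappa_cong) (auto simp: s_def)
      ultimately show ?thesis
        using False by (simp add: b_def)
    qed
    have "(\<Prod>v\<in>?V \<inter> R'. pmf (vfun I v) (\<sigma> v)) = (\<Prod>v\<in>?V \<inter> R'. pmf (vfun I v) (\<tau> v))"
      using eq by (intro prod.cong) auto
    then show "c \<sigma> = c \<tau>"
      unfolding c_def d_eq b_eq by simp
  qed
  moreover have "(\<Sum>\<sigma>\<in>configs I ?V. d \<sigma> * outer_weight I R \<sigma> * pmf (local_resample I \<sigma> R) (\<tau>, R'))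
      = c \<tau> * outer_weight I R' \<tau>" if \<tau>: "\<tau> \<in> configs I ?V" for \<tau>
  proof -
    have s_configs: "s \<rho> \<tau> \<in> configs I ?V" if "\<rho> \<in> configs I R" for \<rho>
      unfolding s_def using that R by (intro override_on_in_configs \<tau>) (auto simp: configs_def)
    have ab: "a e \<rho> S \<tau> = b e \<rho> S \<tau> * (if e \<subseteq> R' then 1 else cfun I e (restrict \<tau> e))"
      if e: "e \<in> ?C" and \<rho>: "\<rho> \<in> configs I R" and S: "S \<in> ?T" for e \<rho> S
    proof (cases "e \<subseteq> R'")
      case True
      then show ?thesis by (simp add: b_def)
    next
      case False
      \<comment> \<open>A failed constraint is contained in the union \<open>R'\<close> of all
        failed ones, so \<open>e\<close> passed its filter.\<close>
      then have "e \<notin> S" using S by blast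
      then have f: "f e \<rho> S \<tau> = kappa I (s \<rho> \<tau>) R e * cfun I e (restrict \<tau> e)"
        by (simp add: f_def)
      show ?thesis
      proof (cases "e \<in> ?E")
        case True
        \<comment> \<open>On the boundary, the old value times \<open>kappa\<close> is the minimum;
          inside \<open>R\<close> the old value is absent and \<open>kappa\<close> itself
          remains.\<close>
        show ?thesis
          using False True f kappa_mult_cfun[OF gm e s_configs[OF \<rho>], of R]
          by (auto simp: a_def b_def mult_ac)
      next
        case outside: False
        \<comment> \<open>No variable of \<open>e\<close> is resampled, so its old factor already is
          its new one.\<close>
        then have "e \<inter> R = {}" using E e by blast
        then have "\<not> e \<subseteq> R" "restrict (s \<rho> \<tau>) e = restrict \<tau> e"
          using graphical_modelD(3)[OF gm e] by (auto simp: s_def override_on_def disjoint_iff intro!: restrict_ext)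
        then show ?thesis
          using False outside by (simp add: a_def b_def)
      qed
    qed
    have term_eq: "outer_weight I R (s \<rho> \<tau>) * (\<Prod>v\<in>R. pmf (vfun I v) (\<tau> v)) * (\<Prod>e\<in>?E. f e \<rho> S \<tau>)
        = (\<Prod>v\<in>?V \<inter> R'. pmf (vfun I v) (\<tau> v)) * (\<Prod>e\<in>?C. b e \<rho> S \<tau>) * outer_weight I R' \<tau>"
      if \<rho>: "\<rho> \<in> configs I R" and S: "S \<in> ?T" for \<rho> S
    proof -
      have "(\<Prod>v\<in>?V - R. pmf (vfun I v) (s \<rho> \<tau> v)) = (\<Prod>v\<in>?V - R. pmf (vfun I v) (\<tau> v))"
        by (intro prod.cong) (auto simp: s_def)
      \<comment> \<open>Old outer factors and fresh values on \<open>R\<close> combine to the full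
        product at \<tau>, which can then be split along \<open>R'\<close> instead.\<close>
      then have vars_eq: "(\<Prod>v\<in>?V - R. pmf (vfun I v) (s \<rho> \<tau> v)) * (\<Prod>v\<in>R. pmf (vfun I v) (\<tau> v))
          = (\<Prod>v\<in>?V. pmf (vfun I v) (\<tau> v))"
        using prod.subset_diff[OF R finV, of "\<lambda>v. pmf (vfun I v) (\<tau> v)"] by simp
      have vars_eq': "(\<Prod>v\<in>?V. pmf (vfun I v) (\<tau> v))
          = (\<Prod>v\<in>?V \<inter> R'. pmf (vfun I v) (\<tau> v)) * (\<Prod>v\<in>?V - R'. pmf (vfun I v) (\<tau> v))"
        by (rule prod.Int_Diff[OF finV])
      \<comment> \<open>Padding with factors 1 puts both products over all constraints, where
        \<open>ab\<close> applies factor by factor.\<close>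
      have "(\<Prod>e\<in>{e \<in> ?C. \<not> e \<subseteq> R}. cfun I e (restrict (s \<rho> \<tau>) e)) * (\<Prod>e\<in>?E. f e \<rho> S \<tau>)
          = (\<Prod>e\<in>?C. a e \<rho> S \<tau>)"
      proof -
        have "(\<Prod>e\<in>{e \<in> ?C. \<not> e \<subseteq> R}. cfun I e (restrict (s \<rho> \<tau>) e))
            = (\<Prod>e\<in>?C. if e \<subseteq> R then 1 else cfun I e (restrict (s \<rho> \<tau>) e))"
          unfolding prod.inter_filter[OF finC] by (intro prod.cong) auto
        moreover have "(\<Prod>e\<in>?E. f e \<rho> S \<tau>) = (\<Prod>e\<in>?C. if e \<in> ?E then f e \<rho> S \<tau> else 1)"
        proof -
          have "?E = {e \<in> ?C. e \<in> ?E}" using E by blast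
          then show ?thesis using prod.inter_filter[OF finC, of "\<lambda>e. f e \<rho> S \<tau>" "\<lambda>e. e \<in> ?E"] by simp
        qed
        ultimately show ?thesis
          by (simp add: a_def prod.distrib)
      qed
      also have "\<dots> = (\<Prod>e\<in>?C. b e \<rho> S \<tau> * (if e \<subseteq> R' then 1 else cfun I e (restrict \<tau> e)))"
        using ab \<rho> S by (intro prod.cong) auto
      also have "\<dots> = (\<Prod>e\<in>?C. b e \<rho> S \<tau>) * (\<Prod>e\<in>{e \<in> ?C. \<not> e \<subseteq> R'}. cfun I e (restrict \<tau> e))"
        unfolding prod.distrib prod.inter_filter[OF finC]
        by (intro arg_cong2[of _ _ _ _ "(*)"] prod.cong) auto
      finally have cons_eq: "(\<Prod>e\<in>{e \<in> ?C. \<not> e \<subseteq> R}. cfun I e (restrict (s \<rho> \<tau>) e)) * (\<Prod>e\<in>?E. f e \<rho> S \<tau>)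
          = (\<Prod>e\<in>?C. b e \<rho> S \<tau>) * (\<Prod>e\<in>{e \<in> ?C. \<not> e \<subseteq> R'}. cfun I e (restrict \<tau> e))" .
      have "outer_weight I R (s \<rho> \<tau>) * (\<Prod>v\<in>R. pmf (vfun I v) (\<tau> v)) * (\<Prod>e\<in>?E. f e \<rho> S \<tau>) =
         ((\<Prod>v\<in>?V - R. pmf (vfun I v) (s \<rho> \<tau> v)) * (\<Prod>v\<in>R. pmf (vfun I v) (\<tau> v))) *
         ((\<Prod>e\<in>{e \<in> ?C. \<not> e \<subseteq> R}. cfun I e (restrict (s \<rho> \<tau>) e)) * (\<Prod>e\<in>?E. f e \<rho> S \<tau>))"
        by (simp add: outer_weight_def mult_ac)
      then show ?thesis
        unfolding vars_eq vars_eq' cons_eq by (simp add: outer_weight_def mult_ac)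
    qed
    let ?h = "\<lambda>\<sigma>. d \<sigma> * outer_weight I R \<sigma> * pmf (local_resample I \<sigma> R) (\<tau>, R')"
    \<comment> \<open>Predecessors that differ from \<tau> off \<open>R\<close> have transition
      probability 0; the others correspond bijectively to their restrictions \<rho> to
      \<open>R\<close>.\<close>
    have "(\<Sum>\<sigma>\<in>configs I ?V. ?h \<sigma>) = (\<Sum>\<sigma>\<in>{\<sigma> \<in> configs I ?V. \<forall>v. v \<notin> R \<longrightarrow> \<sigma> v = \<tau> v}. ?h \<sigma>)"
      using \<tau> by (intro sum.mono_neutral_right)
        (auto simp: pmf_local_resample[OF gm R] finite_configs[OF finV])
    also have "\<dots> = (\<Sum>\<rho>\<in>configs I R. ?h (s \<rho> \<tau>))"
    proof (rule sum.reindex_bij_witness[of _ "\<lambda>\<rho>. s \<rho> \<tau>" "\<lambda>\<sigma>. restrict \<sigma> R"])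
      fix \<sigma> assume \<sigma>: "\<sigma> \<in> {\<sigma> \<in> configs I ?V. \<forall>v. v \<notin> R \<longrightarrow> \<sigma> v = \<tau> v}"
      show eq: "s (restrict \<sigma> R) \<tau> = \<sigma>"
        using \<sigma> by (auto simp: s_def override_on_def fun_eq_iff)
      show "restrict \<sigma> R \<in> configs I R"
        using \<sigma> R by (auto intro: restrict_in_configs)
      show "?h (s (restrict \<sigma> R) \<tau>) = ?h \<sigma>"
        unfolding eq ..
    next
      fix \<rho> assume \<rho>: "\<rho> \<in> configs I R"
      show "restrict (s \<rho> \<tau>) R = \<rho>"
        using \<rho> by (auto simp: s_def configs_def PiE_iff extensional_def restrict_def override_on_def fun_eq_iff)
      show "s \<rho> \<tau> \<in> {\<sigma> \<in> configs I ?V. \<forall>v. v \<notin> R \<longrightarrow> \<sigma> v = \<tau> v}"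
        using s_configs[OF \<rho>] by (auto simp: s_def)
    qed
    also have "\<dots> = (\<Sum>\<rho>\<in>configs I R. \<Sum>S\<in>?T. d (s \<rho> \<tau>) *
        (outer_weight I R (s \<rho> \<tau>) * (\<Prod>v\<in>R. pmf (vfun I v) (\<tau> v)) * (\<Prod>e\<in>?E. f e \<rho> S \<tau>)))"
    proof (rule sum.cong[OF refl])
      fix \<rho> assume \<rho>: "\<rho> \<in> configs I R"
      have "\<forall>v. v \<notin> R \<longrightarrow> s \<rho> \<tau> v = \<tau> v"
        by (simp add: s_def)
      then have "pmf (local_resample I (s \<rho> \<tau>) R) (\<tau>, R') =
          (\<Prod>v\<in>R. pmf (vfun I v) (\<tau> v)) * (\<Sum>S\<in>?T. \<Prod>e\<in>?E. f e \<rho> S \<tau>)"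
        unfolding pmf_local_resample[OF gm R s_configs[OF \<rho>] \<tau>] f_def by simp
      then show "?h (s \<rho> \<tau>) = (\<Sum>S\<in>?T. d (s \<rho> \<tau>) *
          (outer_weight I R (s \<rho> \<tau>) * (\<Prod>v\<in>R. pmf (vfun I v) (\<tau> v)) * (\<Prod>e\<in>?E. f e \<rho> S \<tau>)))"
        by (simp only: sum_distrib_left mult.assoc)
    qed
    also have "\<dots> = (\<Sum>\<rho>\<in>configs I R. \<Sum>S\<in>?T. d (s \<rho> \<tau>) *
        ((\<Prod>v\<in>?V \<inter> R'. pmf (vfun I v) (\<tau> v)) * (\<Prod>e\<in>?C. b e \<rho> S \<tau>) * outer_weight I R' \<tau>))"
      by (intro sum.cong refl arg_cong2[of _ _ _ _ "(*)"] term_eq)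
    also have "\<dots> = c \<tau> * outer_weight I R' \<tau>"
      by (simp only: c_def sum_distrib_right mult.assoc)
    finally show ?thesis .
  qed
  ultimately show ?thesis by blast
qed


section \<open>Iterating the invariant and passing to the limit\<close>

lemma set_pmf_local_resample:
  assumes gm: "graphical_model I" and R: "R \<subseteq> vars I" and \<sigma>: "\<sigma> \<in> configs I (vars I)"
  shows "set_pmf (local_resample I \<sigma> R) \<subseteq> configs I (vars I) \<times> Pow (vars I)"
proof -
  have finR: "finite R"
    using R graphical_modelD(1)[OF gm] finite_subset by blast
  have "override_on \<sigma> Y R \<in> configs I (vars I)" if "Y \<in> set_pmf (Pi_pmf R undefined (vfun I))" for Y
  proof (rule override_on_in_configs[OF \<sigma> _ R])
    fix v assume "v \<in> R"
    then have "v \<in> vars I" "Y v \<in> set_pmf (vfun I v)"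
      using that R by (auto simp: set_Pi_pmf[OF finR] PiE_dflt_def)
    then show "Y v \<in> {1..num_spins I}"
      using graphical_modelD(4)[OF gm] by blast
  qed
  moreover have "\<Union>{e \<in> constraints I. F e} \<subseteq> vars I" for F
    using graphical_modelD(2)[OF gm] by blast
  ultimately show ?thesis
    by (auto simp: local_resample_def Let_def)
qed

lemma outer_weight_empty: "graphical_model I \<Longrightarrow> outer_weight I {} \<sigma> = weight I \<sigma>"
  using graphical_modelD(3)[of I]
  by (auto simp: outer_weight_def weight_def intro!: arg_cong2[of _ _ _ _ "(*)"] prod.cong)

text \<open>Each step replaces \<open>R\<close> and \<open>d\<close>, so the induction generalises
  over both. The point is that \<open>k\<close> does not depend on \<sigma>.\<close>

lemma loop_upto_proportional:
  assumes gm: "graphical_model I" and "R \<subseteq> vars I" "depends_on R d"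
  shows "\<exists>k. \<forall>\<sigma>. (\<Sum>\<tau>\<in>configs I (vars I). d \<tau> * outer_weight I R \<tau> * spmf (loop_upto I n \<tau> R) \<sigma>)
    = k * (if \<sigma> \<in> configs I (vars I) then weight I \<sigma> else 0)"
  using assms(2,3)
proof (induction n arbitrary: R d)
  case 0
  show ?case by (intro exI[of _ 0]) simp
next
  case (Suc n)
  let ?V = "vars I" and ?\<Omega> = "configs I (vars I)"
  note fin\<Omega> = finite_configs[OF graphical_modelD(1)[OF gm], of I]
  show ?case
  proof (cases "R = {}")
    case True
    \<comment> \<open>The zero function is an arbitrary reference point and need not be a
      configuration.\<close>
    have d: "d \<tau> = d (\<lambda>_. 0)" for \<tau>
      using Suc.prems(2) True by (auto simp: depends_on_def)
    have "(\<Sum>\<tau>\<in>?\<Omega>. d \<tau> * outer_weight I R \<tau> * spmf (loop_upto I (Suc n) \<tau> R) \<sigma>)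
        = d (\<lambda>_. 0) * (if \<sigma> \<in> ?\<Omega> then weight I \<sigma> else 0)" for \<sigma>
    proof -
      have "(\<Sum>\<tau>\<in>?\<Omega>. d \<tau> * outer_weight I R \<tau> * spmf (loop_upto I (Suc n) \<tau> R) \<sigma>)
          = (\<Sum>\<tau>\<in>?\<Omega>. if \<tau> = \<sigma> then d (\<lambda>_. 0) * weight I \<sigma> else 0)"
        using True by (intro sum.cong refl) (auto simp: outer_weight_empty[OF gm] d[of \<sigma>] indicator_def)
      then show ?thesis by (simp add: fin\<Omega>)
    qed
    then show ?thesis by blast
  next
    case False
    have "\<exists>c. \<forall>R'. depends_on R' (c R') \<and> (\<forall>\<tau>\<in>?\<Omega>.
      (\<Sum>\<sigma>\<in>?\<Omega>. d \<sigma> * outer_weight I R \<sigma> * pmf (local_resample I \<sigma> R) (\<tau>, R')) = c R' \<tau> * outer_weight I R' \<tau>)"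
      using local_resample_outer_weight[OF gm Suc.prems] by (intro choice allI) blast
    then obtain c where c_dep: "\<And>R'. depends_on R' (c R')"
      and c: "\<And>R' \<tau>. \<tau> \<in> ?\<Omega> \<Longrightarrow>
        (\<Sum>\<sigma>\<in>?\<Omega>. d \<sigma> * outer_weight I R \<sigma> * pmf (local_resample I \<sigma> R) (\<tau>, R')) = c R' \<tau> * outer_weight I R' \<tau>"
      by blast
    have "\<exists>k. \<forall>R'\<in>Pow ?V. \<forall>\<sigma>.
        (\<Sum>\<tau>\<in>?\<Omega>. c R' \<tau> * outer_weight I R' \<tau> * spmf (loop_upto I n \<tau> R') \<sigma>)
          = k R' * (if \<sigma> \<in> ?\<Omega> then weight I \<sigma> else 0)"
      using Suc.IH c_dep by (intro bchoice) blast
    then obtain k where k: "\<And>R' \<sigma>. R' \<in> Pow ?V \<Longrightarrow>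
        (\<Sum>\<tau>\<in>?\<Omega>. c R' \<tau> * outer_weight I R' \<tau> * spmf (loop_upto I n \<tau> R') \<sigma>)
          = k R' * (if \<sigma> \<in> ?\<Omega> then weight I \<sigma> else 0)"
      by blast
    have "(\<Sum>\<rho>\<in>?\<Omega>. d \<rho> * outer_weight I R \<rho> * spmf (loop_upto I (Suc n) \<rho> R) \<sigma>)
        = (\<Sum>R'\<in>Pow ?V. k R') * (if \<sigma> \<in> ?\<Omega> then weight I \<sigma> else 0)" for \<sigma>
    proof -
      have step: "spmf (loop_upto I (Suc n) \<rho> R) \<sigma> =
          (\<Sum>\<tau>\<in>?\<Omega>. \<Sum>R'\<in>Pow ?V. pmf (local_resample I \<rho> R) (\<tau>, R') * spmf (loop_upto I n \<tau> R') \<sigma>)"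
        if "\<rho> \<in> ?\<Omega>" for \<rho>
      proof -
        have "spmf (loop_upto I (Suc n) \<rho> R) \<sigma> =
            (\<integral>y. spmf (loop_upto I n (fst y) (snd y)) \<sigma> \<partial>measure_pmf (local_resample I \<rho> R))"
          using False by (simp add: spmf_bind del: bind_spmf_of_pmf)
        also have "\<dots> = (\<Sum>y\<in>?\<Omega> \<times> Pow ?V.
            pmf (local_resample I \<rho> R) y *\<^sub>R spmf (loop_upto I n (fst y) (snd y)) \<sigma>)"
          using set_pmf_local_resample[OF gm Suc.prems(1) that] fin\<Omega> graphical_modelD(1)[OF gm]
          by (intro integral_measure_pmf) auto
        finally show ?thesis
          by (simp add: sum.cartesian_product case_prod_beta)
      qed
      have "(\<Sum>\<rho>\<in>?\<Omega>. d \<rho> * outer_weight I R \<rho> * spmf (loop_upto I (Suc n) \<rho> R) \<sigma>)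
          = (\<Sum>\<rho>\<in>?\<Omega>. \<Sum>\<tau>\<in>?\<Omega>. \<Sum>R'\<in>Pow ?V. d \<rho> * outer_weight I R \<rho> *
              pmf (local_resample I \<rho> R) (\<tau>, R') * spmf (loop_upto I n \<tau> R') \<sigma>)"
        by (intro sum.cong refl) (simp only: step sum_distrib_left mult.assoc)
      \<comment> \<open>Summing over the predecessor \<rho> first exposes the one-step identity
        \<open>c\<close>.\<close>
      also have "\<dots> = (\<Sum>\<tau>\<in>?\<Omega>. \<Sum>R'\<in>Pow ?V. \<Sum>\<rho>\<in>?\<Omega>. d \<rho> * outer_weight I R \<rho> *
              pmf (local_resample I \<rho> R) (\<tau>, R') * spmf (loop_upto I n \<tau> R') \<sigma>)"
        by (subst sum.swap) (intro sum.cong refl sum.swap)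
      also have "\<dots> = (\<Sum>\<tau>\<in>?\<Omega>. \<Sum>R'\<in>Pow ?V.
          c R' \<tau> * outer_weight I R' \<tau> * spmf (loop_upto I n \<tau> R') \<sigma>)"
        by (intro sum.cong refl) (simp only: sum_distrib_right[symmetric] c)
      also have "\<dots> = (\<Sum>R'\<in>Pow ?V. k R' * (if \<sigma> \<in> ?\<Omega> then weight I \<sigma> else 0))"
        by (subst sum.swap) (intro sum.cong refl k)
      finally show ?thesis
        by (simp only: sum_distrib_right)
    qed
    then show ?thesis by blast
  qed
qed

text \<open>A point with nonzero \<open>w\<close> forces \<open>k\<close> to converge; without one,
  \<open>k\<close> may diverge but every limit is 0.\<close>

lemma proportional_limit:
  fixes h w :: "'a \<Rightarrow> real"
  assumes "\<And>x. (\<lambda>n. k n * w x) \<longlonglongrightarrow> h x"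
  shows "\<exists>c. \<forall>x. h x = c * w x"
proof (cases "\<exists>y. w y \<noteq> 0")
  case True
  then obtain y where "w y \<noteq> 0" by blast
  then have "k \<longlonglongrightarrow> h y / w y"
    using tendsto_divide[OF assms[of y] tendsto_const[of "w y"]] by simp
  then have "h x = h y / w y * w x" for x
    using LIMSEQ_unique[OF assms[of x]] tendsto_mult_right by blast
  then show ?thesis by blast
next
  case False
  then have "h x = 0" for x
    using assms[of x] by (simp add: LIMSEQ_const_iff)
  with False show ?thesis by auto
qed

lemma resample_loop_proportional:
  assumes gm: "graphical_model I" and "R \<subseteq> vars I" "depends_on R d"
  shows "\<exists>k. \<forall>\<sigma>. (\<Sum>\<tau>\<in>configs I (vars I). d \<tau> * outer_weight I R \<tau> * spmf (resample_loop I \<tau> R) \<sigma>)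
    = k * (if \<sigma> \<in> configs I (vars I) then weight I \<sigma> else 0)"
proof -
  have "\<exists>k. \<forall>n \<sigma>.
      (\<Sum>\<tau>\<in>configs I (vars I). d \<tau> * outer_weight I R \<tau> * spmf (loop_upto I n \<tau> R) \<sigma>)
        = k n * (if \<sigma> \<in> configs I (vars I) then weight I \<sigma> else 0)"
    using loop_upto_proportional[OF assms] by (intro choice allI)
  then obtain k where k: "\<And>n \<sigma>.
      (\<Sum>\<tau>\<in>configs I (vars I). d \<tau> * outer_weight I R \<tau> * spmf (loop_upto I n \<tau> R) \<sigma>)
        = k n * (if \<sigma> \<in> configs I (vars I) then weight I \<sigma> else 0)"
    by blast
  show ?thesis
    by (rule proportional_limit[of k], subst k[symmetric])
      (intro tendsto_sum tendsto_mult tendsto_const LIMSEQ_spmf_loop_upto)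
qed

section \<open>The initial distribution and the output law\<close>

text \<open>The bracketed factor depends only on the values on \<open>R\<close>; it provides the
  initial \<open>d\<close>.\<close>

lemma weight_eq_inner_outer:
  assumes "graphical_model I" "R \<subseteq> vars I"
  shows "weight I \<sigma> =
    ((\<Prod>v\<in>R. pmf (vfun I v) (\<sigma> v)) * (\<Prod>e\<in>{e \<in> constraints I. e \<subseteq> R}. cfun I e (restrict \<sigma> e))) *
    outer_weight I R \<sigma>"
proof -
  have "(\<Prod>v\<in>vars I. pmf (vfun I v) (\<sigma> v)) =
      (\<Prod>v\<in>vars I - R. pmf (vfun I v) (\<sigma> v)) * (\<Prod>v\<in>R. pmf (vfun I v) (\<sigma> v))"
    by (rule prod.subset_diff[OF assms(2) graphical_modelD(1)[OF assms(1)]])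
  moreover have "{e \<in> constraints I. \<not> e \<subseteq> R} = constraints I - {e \<in> constraints I. e \<subseteq> R}"
    by blast
  then have "(\<Prod>e\<in>constraints I. cfun I e (restrict \<sigma> e)) =
      (\<Prod>e\<in>{e \<in> constraints I. \<not> e \<subseteq> R}. cfun I e (restrict \<sigma> e)) *
      (\<Prod>e\<in>{e \<in> constraints I. e \<subseteq> R}. cfun I e (restrict \<sigma> e))"
    using prod.subset_diff[of "{e \<in> constraints I. e \<subseteq> R}" "constraints I"]
      finite_constraints[OF assms(1)] by simp
  ultimately show ?thesis
    by (simp add: weight_def outer_weight_def mult_ac)
qed

text \<open>Updated variables lie in \<open>vbl U\<close> and updated constraints are contained in
  it, so every factor counted here is untouched.\<close>

lemma outer_weight_apply_update:
  "outer_weight (apply_update I U) (vbl U) \<sigma> = outer_weight I (vbl U) \<sigma>"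
proof -
  have "{e \<in> constraints (apply_update I U). \<not> e \<subseteq> vbl U} = {e \<in> constraints I. \<not> e \<subseteq> vbl U}"
    by (auto simp: apply_update_def vbl_def)
  moreover have "cfun (apply_update I U) e = cfun I e" if "\<not> e \<subseteq> vbl U" for e
  proof -
    have "e \<notin> upd_constraints U" using that by (auto simp: vbl_def)
    then show ?thesis by (simp add: apply_update_def)
  qed
  moreover have "vfun (apply_update I U) v = vfun I v" if "v \<notin> vbl U" for v
    using that by (simp add: apply_update_def vbl_def)
  ultimately show ?thesis
    by (auto simp: outer_weight_def apply_update_def intro!: arg_cong2[of _ _ _ _ "(*)"] prod.cong)
qed

theorem theorem1:
  fixes I :: "'v gmodel" and U :: "'v update"
    and X :: "('v \<Rightarrow> nat) pmf" and out :: "('v \<Rightarrow> nat) spmf"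
  assumes "graphical_model I"
    and "valid_update I U"
    and "\<And>\<sigma>. pmf X \<sigma> = gibbs I \<sigma>"
    and "out = bind_spmf (spmf_of_pmf X) (dynamic_sampler I U)"
    and "weight_spmf out > 0"
  shows "\<forall>\<sigma>. spmf (cond_spmf out UNIV) \<sigma> = gibbs (apply_update I U) \<sigma>"
proof -
  define J where "J = apply_update I U"
  let ?\<Omega> = "configs I (vars I)" and ?R = "vbl U"
  have gmJ: "graphical_model J"
    unfolding J_def by (rule graphical_model_apply_update[OF assms(1,2)])
  have J: "vars J = vars I" "configs J = configs I"
    by (auto simp: J_def apply_update_def configs_def fun_eq_iff)
  have R: "?R \<subseteq> vars I"
    using assms(2) by (auto simp: valid_update_def vbl_def)
  have fin: "finite ?\<Omega>"
    by (rule finite_configs[OF graphical_modelD(1)[OF assms(1)]])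
  \<comment> \<open>The inner factors and the partition function both come from the old model, so
    that \<open>d\<close> times the outer weight is the law of \<open>X\<close>.\<close>
  define d where "d \<sigma> =
    ((\<Prod>v\<in>?R. pmf (vfun I v) (\<sigma> v)) * (\<Prod>e\<in>{e \<in> constraints I. e \<subseteq> ?R}. cfun I e (restrict \<sigma> e)))
      / (\<Sum>\<tau>\<in>?\<Omega>. weight I \<tau>)" for \<sigma>
  have "depends_on ?R d"
    unfolding depends_on_def
  proof (intro allI impI)
    fix \<sigma> \<tau> :: "'v \<Rightarrow> nat" assume eq: "\<forall>v\<in>?R. \<sigma> v = \<tau> v"
    have "restrict \<sigma> e = restrict \<tau> e" if "e \<subseteq> ?R" for e
      using eq that by (intro restrict_ext) blast
    then show "d \<sigma> = d \<tau>"
      using eq by (simp add: d_def)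
  qed
  then obtain k where k: "\<And>\<sigma>.
      (\<Sum>\<tau>\<in>?\<Omega>. d \<tau> * outer_weight J ?R \<tau> * spmf (resample_loop J \<tau> ?R) \<sigma>)
        = k * (if \<sigma> \<in> ?\<Omega> then weight J \<sigma> else 0)"
    using resample_loop_proportional[OF gmJ, of ?R d] R unfolding J by blast
  have out: "spmf out \<sigma> = k * (if \<sigma> \<in> ?\<Omega> then weight J \<sigma> else 0)" for \<sigma>
  proof -
    have "spmf out \<sigma> = (\<integral>\<tau>. spmf (resample_loop J \<tau> ?R) \<sigma> \<partial>measure_pmf X)"
      unfolding assms(4) spmf_bind by (simp add: dynamic_sampler_def J_def)
    also have "\<dots> = (\<Sum>\<tau>\<in>?\<Omega>. pmf X \<tau> *\<^sub>R spmf (resample_loop J \<tau> ?R) \<sigma>)"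
      using fin by (intro integral_measure_pmf) (auto simp: set_pmf_eq assms(3) gibbs_def split: if_splits)
    also have "\<dots> = (\<Sum>\<tau>\<in>?\<Omega>. d \<tau> * outer_weight J ?R \<tau> * spmf (resample_loop J \<tau> ?R) \<sigma>)"
      by (intro sum.cong refl)
        (simp add: assms(3) gibbs_def d_def J_def outer_weight_apply_update
          weight_eq_inner_outer[OF assms(1) R])
    finally show ?thesis
      by (simp only: k)
  qed
  \<comment> \<open>The total output mass is the sum of \<open>spmf out\<close> over configurations,
    i.e. \<open>k\<close> times the new partition function. Conditioning divides by it and cancels
    \<open>k\<close>, which is nonzero because termination has positive probability.\<close>
  have "weight_spmf out = measure (measure_spmf out) ?\<Omega>"
  proof -
    have "set_spmf out \<subseteq> ?\<Omega>"
      by (auto simp: in_set_spmf_iff_spmf out split: if_splits)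
    then show ?thesis
      by (auto intro!: measure_spmf.finite_measure_eq_AE)
  qed
  also have "\<dots> = (\<Sum>\<sigma>\<in>?\<Omega>. spmf out \<sigma>)"
    unfolding spmf_conv_measure_spmf
    using fin by (intro measure_spmf.finite_measure_eq_sum_singleton) auto
  also have "\<dots> = k * (\<Sum>\<sigma>\<in>?\<Omega>. weight J \<sigma>)"
    by (simp add: out sum_distrib_left)
  finally have W: "weight_spmf out = k * (\<Sum>\<sigma>\<in>?\<Omega>. weight J \<sigma>)" .
  then have "k \<noteq> 0"
    using assms(5) by auto
  then show ?thesis
    using W unfolding J_def[symmetric] by (auto simp: out gibbs_def J weight_spmf_def)
qed

end
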